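(* (Soundness.) For every $\delta'$ returned by the procedure ParamRepair$(M,ERR,\mathit{initConstr})$: (i) in $\mathrm{Restrict}(M,\delta')$ no state of ${\uparrow}ERR$ is reachable from an initial state, and (ii) every local state $q\in Q_A\cup Q_B$ has at least one outgoing local transition in $\delta'$.
   Context: Disjunctive templates: $Q_A,Q_B$ disjoint finite sets, $Q=Q_A\cup Q_B$; $U=(Q_U,\mathit{init}_U,\mathcal G_U,\delta_U)$, $U\in\{A,B\}$, with guards $\mathcal G_U\subseteq\mathcal P(Q)$ and total $\delta_U\subseteq Q_U\times\mathcal G_U\times Q_U$; $\delta=\delta_A\cup\delta_B$, $\delta_U(q)$ the outgoing transitions of $q$. Write $Q_B=\{q_0,\dots\}$, $\vec u_i$ unit vectors. The counter system $M=(S,S_0,\Delta)$: $S=Q_A\times\mathbb N_0^{|B|}$, $S_0=\{(\mathit{init}_A,\vec c)\mid\vec c(q)=0\text{ for }q\ne\mathit{init}_B\}$; $s\xrightarrow{t}s'$ for $t\in\delta$ iff (1) $t=(q_A,g,q'_A)\in\delta_A$, $s=(q_A,\vec c)$, $s'=(q'_A,\vec c)$, and some $q_i\in g\cap Q_B$ has $\vec c(i)\ge1$; or (2) $t=(q_i,g,q_j)\in\delta_B$, $s=(q_A,\vec c)$, $s'=(q_A,\vec c-\vec u_i+\vec u_j)$, $\vec c(i)\ge1$, and ($q_A\in g$, or some $q_l\in g\cap Q_B$, $l\ne i$, with $\vec c(l)\ge1$, or $q_i\in g$, $\vec c(i)\ge2$). For $\delta'\subseteq\delta$, $\mathrm{Restrict}(M,\delta')$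 is the counter system defined in the same way using only local transitions in $\delta'$. Order $(q_A,\vec c)\lessapprox(q'_A,\vec d)$ iff $q_A=q'_A$, $\vec c\le\vec d$; ${\uparrow}$ upward closure, $\mathit{minBasis}$ the set of minimal elements; $\mathit{pred}$/$\mathit{Succ}$ one-step predecessors/successors in the current system. $ERR\subseteq S$ finite. Elements of $\delta$ are propositional variables; $\delta'\subseteq\delta$ is identified with the assignment making exactly $\delta'$ true. $TRConstr=\bigwedge_{q\in Q_A}\bigvee_{t\in\delta_A(q)}t\wedge\bigwedge_{q\in Q_B}\bigvee_{t\in\delta_B(q)}t$; $\mathit{initConstr}$ is a propositional formula over $\delta$ having $TRConstr$ as a conjunct. ModelCheck$(M')$: set $E_0=ERR$, $\mathit{temp}=ERR$, $\mathit{visited}=\emptyset$, $i=1$; while $\mathit{temp}\ne\mathit{visited}$: $\mathit{visited}:=\mathit{temp}$; $E_i:=\mathit{minBasis}(\mathit{pred}({\uparrow}E_{i-1}))$ in $M'$; if $E_i\cap S_0\ne\emptyset$ return (False, $E_0,\dots,E_{i-1},E_i\cap S_0$); $\mathit{temp}:=\mathit{minBasis}(\mathit{visited}\cup E_i)$; $i:=i+1$; finally return True. ParamRepair$(M,ERR,\mathit{initConstr})$: $M':=M$, $\delta':=\delta$, $\mathit{acc}:=\mathit{true}$; loop: if ModelCheck$(M')$ returns True, return $\delta'$; otherwise with output $E_0,\dots,E_k$ set $RE_k:=E_k$, $RE_{i-1}:=\mathit{Succ}(RE_i)\cap{\uparrow}E_{i-1}$ (in $M'$), $\mathit{acc}:=\bigwedge_{s\in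 RE_k}\mathrm{BC}(s,[RE_{k-1},\dots,RE_0])\wedge\mathit{acc}$; if $\mathit{acc}\wedge\mathit{initConstr}$ is unsatisfiable return "Unrealizable"; else let $\delta'$ be a satisfying assignment and $M':=\mathrm{Restrict}(M,\delta')$. Here $\mathrm{BC}(s,[X_1,\dots,X_m])$: let $L$ be the set of local transitions $t$ enabled in $s$ in $M'$ with $s\xrightarrow{t}s_t$ for some $s_t\in X_1$; if $m=1$ return $\bigwedge_{t\in L}\neg t$, else return $\bigwedge_{t\in L}(\neg t\vee\mathrm{BC}(s_t,[X_2,\dots,X_m]))$.
   Formalization: Clause (i) is proved assuming ERR contains no initial state, since ModelCheck never tests E_0 = ERR against S_0 and (i) otherwise fails via the empty path; without that assumption it is proved for paths of at least one step. *)

theory Defs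
  imports Main "HOL-Library.FSet"
begin

section \<open>Process templates\<close>

text \<open>A local transition is a triple (source, guard, target).\<close>

type_synonym 'q ltrans = "'q \<times> 'q set \<times> 'q"

record 'q template =
  locs :: "'q set"
  linit :: 'q
  guards :: "'q set set"
  rules :: "'q ltrans set"

definition outgoing :: "'q ltrans set \<Rightarrow> 'q \<Rightarrow> 'q ltrans set" where
  "outgoing T q = {t \<in> T. fst t = q}"

text \<open>The first argument is the set of all local states, over which guards range.
  Totality of the transition relation means that every local state has an outgoing transition.\<close>

definition disjunctive_template :: "'q set \<Rightarrow> 'q template \<Rightarrow> bool" where
  "disjunctive_template Q U \<longleftrightarrow>
     finite (locs U) \<and> linit U \<in> locs U \<and> guards U \<subseteq> Pow Q \<and>
     rules U \<subseteq> locs U \<times> guards U \<times> locs U \<and>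
     (\<forall>q \<in> locs U. outgoing (rules U) q \<noteq> {})"

definition disjunctive_templates :: "'q template \<Rightarrow> 'q template \<Rightarrow> bool" where
  "disjunctive_templates A B \<longleftrightarrow>
     locs A \<inter> locs B = {} \<and>
     disjunctive_template (locs A \<union> locs B) A \<and> disjunctive_template (locs A \<union> locs B) B"

definition all_rules :: "'q template \<Rightarrow> 'q template \<Rightarrow> 'q ltrans set" where
  "all_rules A B = rules A \<union> rules B"

section \<open>Counter systems\<close>

text \<open>Counter vectors are indexed by the local states of \<open>B\<close> themselves; they are functions
  vanishing outside \<open>locs B\<close>, so that equality and order are those of the index set \<open>locs B\<close>.\<close>

type_synonym 'q config = "'q \<times> ('q \<Rightarrow> nat)"

record 'q csys =
  states :: "'q config set"
  inits :: "'q config set"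
  steps :: "('q config \<times> 'q ltrans \<times> 'q config) set"

definition configs :: "'q template \<Rightarrow> 'q template \<Rightarrow> 'q config set" where
  "configs A B = {(q, c). q \<in> locs A \<and> (\<forall>r. r \<notin> locs B \<longrightarrow> c r = 0)}"

definition init_configs :: "'q template \<Rightarrow> 'q template \<Rightarrow> 'q config set" where
  "init_configs A B = {(q, c). q = linit A \<and> (\<forall>r. r \<noteq> linit B \<longrightarrow> c r = 0)}"

definition unit_vec :: "'q \<Rightarrow> 'q \<Rightarrow> nat" where
  "unit_vec q r = (if r = q then 1 else 0)"

inductive fires ::
  "'q template \<Rightarrow> 'q template \<Rightarrow> 'q ltrans \<Rightarrow> 'q config \<Rightarrow> 'q config \<Rightarrow> bool"
  for A B :: "'q template" where
  fires_A: "\<lbrakk>(a, g, a') \<in> rules A; (a, c) \<in> configs A B;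
     \<exists>q \<in> g \<inter> locs B. c q \<ge> 1\<rbrakk>
   \<Longrightarrow> fires A B (a, g, a') (a, c) (a', c)"
| fires_B: "\<lbrakk>(p, g, p') \<in> rules B; (a, c) \<in> configs A B; c p \<ge> 1;
     a \<in> g \<or> (\<exists>q \<in> g \<inter> locs B. q \<noteq> p \<and> c q \<ge> 1) \<or> (p \<in> g \<and> c p \<ge> 2)\<rbrakk>
   \<Longrightarrow> fires A B (p, g, p') (a, c) (a, \<lambda>r. c r - unit_vec p r + unit_vec p' r)"

definition counter_system :: "'q template \<Rightarrow> 'q template \<Rightarrow> 'q csys" where
  "counter_system A B =
     \<lparr>states = configs A B, inits = init_configs A B, steps = {(s, t, s'). fires A B t s s'}\<rparr>"

definition restrict_csys :: "'q csys \<Rightarrow> 'q ltrans set \<Rightarrow> 'q csys" where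
  "restrict_csys M \<delta>' = M\<lparr>steps := {(s, t, s') \<in> steps M. t \<in> \<delta>'}\<rparr>"

definition one_step :: "'q csys \<Rightarrow> 'q config rel" where
  "one_step M = {(s, s'). \<exists>t. (s, t, s') \<in> steps M}"

definition pred :: "'q csys \<Rightarrow> 'q config set \<Rightarrow> 'q config set" where
  "pred M X = {s. \<exists>s' \<in> X. (s, s') \<in> one_step M}"

definition succs :: "'q csys \<Rightarrow> 'q config set \<Rightarrow> 'q config set" where
  "succs M X = {s'. \<exists>s \<in> X. (s, s') \<in> one_step M}"

definition config_le :: "'q config \<Rightarrow> 'q config \<Rightarrow> bool" where
  "config_le s s' \<longleftrightarrow> fst s = fst s' \<and> snd s \<le> snd s'"

definition up :: "'q csys \<Rightarrow> 'q config set \<Rightarrow> 'q config set" where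
  "up M X = {s \<in> states M. \<exists>x \<in> X. config_le x s}"

definition min_basis :: "'q config set \<Rightarrow> 'q config set" where
  "min_basis X = {x \<in> X. \<forall>y \<in> X. config_le y x \<longrightarrow> y = x}"

section \<open>Propositional formulas\<close>

datatype 'v form =
  Var 'v
| Neg "'v form"
| Conj "'v form fset"
| Disj "'v form fset"

primrec sat :: "'v set \<Rightarrow> 'v form \<Rightarrow> bool" where
  "sat V (Var v) \<longleftrightarrow> v \<in> V"
| "sat V (Neg \<phi>) \<longleftrightarrow> \<not> sat V \<phi>"
| "sat V (Conj F) \<longleftrightarrow> (\<forall>b |\<in>| fimage (sat V) F. b)"
| "sat V (Disj F) \<longleftrightarrow> (\<exists>b |\<in>| fimage (sat V) F. b)"

abbreviation true_form :: "'v form" where "true_form \<equiv> Conj {||}"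
abbreviation conj2 :: "'v form \<Rightarrow> 'v form \<Rightarrow> 'v form" where "conj2 \<phi> \<psi> \<equiv> Conj {|\<phi>, \<psi>|}"
abbreviation disj2 :: "'v form \<Rightarrow> 'v form \<Rightarrow> 'v form" where "disj2 \<phi> \<psi> \<equiv> Disj {|\<phi>, \<psi>|}"

text \<open>Conjunction and disjunction of a set of formulas. \<open>Abs_fset\<close> is specified only on finite
  sets; all the sets occurring below are finite when \<open>disjunctive_templates A B\<close> holds and the
  error set is finite.\<close>

definition big_conj :: "'v form set \<Rightarrow> 'v form" where
  "big_conj X = Conj (Abs_fset X)"

definition big_disj :: "'v form set \<Rightarrow> 'v form" where
  "big_disj X = Disj (Abs_fset X)"

inductive is_conjunct :: "'v form \<Rightarrow> 'v form \<Rightarrow> bool" for \<chi> where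
  is_conjunct_refl: "is_conjunct \<chi> \<chi>"
| is_conjunct_Conj: "\<lbrakk>\<phi> |\<in>| F; is_conjunct \<chi> \<phi>\<rbrakk> \<Longrightarrow> is_conjunct \<chi> (Conj F)"

definition TRConstr :: "'q template \<Rightarrow> 'q template \<Rightarrow> 'q ltrans form" where
  "TRConstr A B = conj2
     (big_conj ((\<lambda>q. big_disj (Var ` outgoing (rules A) q)) ` locs A))
     (big_conj ((\<lambda>q. big_disj (Var ` outgoing (rules B) q)) ` locs B))"

section \<open>Model checking\<close>

datatype 'q mc_result = MC_True | MC_False "'q config set list"

text \<open>Big-step semantics of the loop: \<open>mc_loop M Es temp visited r\<close> means that the loop, entered
  with \<open>Es = [E\<^sub>0, \<dots>, E\<^bsub>i-1\<^esub>]\<close> and the given values of the program variables, terminates with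
  result \<open>r\<close>. Only later iterates, and not \<open>E\<^sub>0\<close>, are compared with the initial states.\<close>

inductive mc_loop ::
  "'q csys \<Rightarrow> 'q config set list \<Rightarrow> 'q config set \<Rightarrow> 'q config set \<Rightarrow> 'q mc_result \<Rightarrow> bool"
  for M where
  mc_done: "temp = visited \<Longrightarrow> mc_loop M Es temp visited MC_True"
| mc_error: "\<lbrakk>temp \<noteq> visited; E = min_basis (pred M (up M (last Es))); E \<inter> inits M \<noteq> {}\<rbrakk>
   \<Longrightarrow> mc_loop M Es temp visited (MC_False (Es @ [E \<inter> inits M]))"
| mc_iter: "\<lbrakk>temp \<noteq> visited; E = min_basis (pred M (up M (last Es))); E \<inter> inits M = {};
     mc_loop M (Es @ [E]) (min_basis (temp \<union> E)) temp r\<rbrakk>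
   \<Longrightarrow> mc_loop M Es temp visited r"

definition model_check :: "'q csys \<Rightarrow> 'q config set \<Rightarrow> 'q mc_result \<Rightarrow> bool" where
  "model_check M ERR r \<longleftrightarrow> mc_loop M [ERR] ERR {} r"

section \<open>Repair\<close>

text \<open>\<open>re_chain M RE\<^sub>k [E\<^bsub>k-1\<^esub>, \<dots>, E\<^sub>0] = [RE\<^bsub>k-1\<^esub>, \<dots>, RE\<^sub>0]\<close>\<close>

primrec re_chain ::
  "'q csys \<Rightarrow> 'q config set \<Rightarrow> 'q config set list \<Rightarrow> 'q config set list" where
  "re_chain M X [] = []"
| "re_chain M X (E # Es) = (let Y = succs M X \<inter> up M E in Y # re_chain M Y Es)"

text \<open>Given \<open>s\<close> and \<open>t\<close> there is at most one \<open>s'\<close> with \<open>(s, t, s') \<in> steps M\<close>, so ranging over the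
  pairs \<open>(t, s')\<close> below is the same as ranging over the transitions \<open>t\<close>. The list argument is
  never empty.\<close>

fun BC :: "'q csys \<Rightarrow> 'q config \<Rightarrow> 'q config set list \<Rightarrow> 'q ltrans form" where
  "BC M s [X] = big_conj {Neg (Var t) | t s'. (s, t, s') \<in> steps M \<and> s' \<in> X}"
| "BC M s (X # Y # Xs) =
     big_conj {disj2 (Neg (Var t)) (BC M s' (Y # Xs)) | t s'. (s, t, s') \<in> steps M \<and> s' \<in> X}"

definition refine :: "'q csys \<Rightarrow> 'q config set list \<Rightarrow> 'q ltrans form \<Rightarrow> 'q ltrans form" where
  "refine M Es acc =
     (let RE = last Es; REs = re_chain M RE (rev (butlast Es))
      in conj2 (big_conj ((\<lambda>s. BC M s REs) ` RE)) acc)"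

datatype 'q repair_result = Repaired "'q ltrans set" | Unrealizable

text \<open>\<open>repair_loop A B ERR \<phi> M' \<delta>' acc r\<close> means that the loop, entered with the values \<open>M'\<close>, \<open>\<delta>'\<close>
  and \<open>acc\<close>, can terminate with result \<open>r\<close>; the choice of the satisfying assignment is
  nondeterministic.\<close>

inductive repair_loop ::
  "'q template \<Rightarrow> 'q template \<Rightarrow> 'q config set \<Rightarrow> 'q ltrans form \<Rightarrow>
   'q csys \<Rightarrow> 'q ltrans set \<Rightarrow> 'q ltrans form \<Rightarrow> 'q repair_result \<Rightarrow> bool"
  for A B ERR initConstr where
  repair_done: "model_check M' ERR MC_True
   \<Longrightarrow> repair_loop A B ERR initConstr M' \<delta>' acc (Repaired \<delta>')"
| repair_fail: "\<lbrakk>model_check M' ERR (MC_False Es); acc' = refine M' Es acc;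
     \<not> (\<exists>\<delta>'' \<subseteq> all_rules A B. sat \<delta>'' (conj2 acc' initConstr))\<rbrakk>
   \<Longrightarrow> repair_loop A B ERR initConstr M' \<delta>' acc Unrealizable"
| repair_iter: "\<lbrakk>model_check M' ERR (MC_False Es); acc' = refine M' Es acc;
     \<delta>'' \<subseteq> all_rules A B; sat \<delta>'' (conj2 acc' initConstr);
     repair_loop A B ERR initConstr (restrict_csys (counter_system A B) \<delta>'') \<delta>'' acc' r\<rbrakk>
   \<Longrightarrow> repair_loop A B ERR initConstr M' \<delta>' acc r"

definition param_repair ::
  "'q template \<Rightarrow> 'q template \<Rightarrow> 'q config set \<Rightarrow> 'q ltrans form \<Rightarrow> 'q repair_result \<Rightarrow> bool" where
  "param_repair A B ERR initConstr r \<longleftrightarrow>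
     repair_loop A B ERR initConstr (counter_system A B) (all_rules A B) true_form r"

end

theory Submission
  imports Defs
begin

text \<open>
  When the model checker answers True, the union \<open>F\<close> of the iterates \<open>E\<^sub>1, E\<^sub>2, \<dots>\<close> avoids the
  initial states, and stabilisation of the visited set makes \<open>up M F\<close> contain every predecessor of
  \<open>up M (ERR \<union> F)\<close>. Hence everything that reaches \<open>up M ERR\<close> in at least one step lies in \<open>up M F\<close>,
  which contains no initial state because the initial states are closed downwards. Compatibility
  of the order with the steps is not needed. The guarantee on outgoing transitions
  comes from \<open>TRConstr\<close>, or from totality of the templates if the first check already succeeds.
\<close>

lemma up_Un: "up M (X \<union> Y) = up M X \<union> up M Y"
  by (auto simp: up_def)

lemma up_mono: "X \<subseteq> Y \<Longrightarrow> up M X \<subseteq> up M Y"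
  by (auto simp: up_def)

lemma pred_mono: "X \<subseteq> Y \<Longrightarrow> pred M X \<subseteq> pred M Y"
  by (auto simp: pred_def)

lemma pred_Un: "pred M (X \<union> Y) = pred M X \<union> pred M Y"
  by (auto simp: pred_def)

lemma config_le_trans: "config_le x y \<Longrightarrow> config_le y z \<Longrightarrow> config_le x z"
  by (auto simp: config_le_def)

lemma configs_downward_closed:
  assumes "x \<in> configs A B" "config_le y x"
  shows "y \<in> configs A B"
proof -
  have "snd y r \<le> snd x r" for r
    using assms(2) by (simp add: config_le_def le_fun_def)
  then have "snd x r = 0 \<Longrightarrow> snd y r = 0" for r
    by (metis le_zero_eq)
  then show ?thesis
    using assms by (cases x, cases y) (simp add: configs_def config_le_def)
qed

text \<open>Only the counter of \<open>linit B\<close> may be nonzero, and it is unbounded, so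
  lowering counters keeps a configuration initial. Consequently, if \<open>X\<close> contains no
  initial state, neither does \<open>up M X\<close>.\<close>

lemma init_configs_downward_closed:
  assumes "x \<in> init_configs A B" "config_le y x"
  shows "y \<in> init_configs A B"
proof -
  have "snd y r \<le> snd x r" for r
    using assms(2) by (simp add: config_le_def le_fun_def)
  then have "snd x r = 0 \<Longrightarrow> snd y r = 0" for r
    by (metis le_zero_eq)
  then show ?thesis
    using assms by (cases x, cases y) (simp add: init_configs_def config_le_def)
qed

text \<open>Descent on the sum of all counters: a strictly smaller configuration has the same
  location and a smaller sum over the finite set \<open>locs B\<close>. The set \<open>X\<close> may
  be infinite.\<close>

lemma ex_min_basis_le:
  assumes fin: "finite (locs B)" and "x \<in> X" "x \<in> configs A B"
  shows "\<exists>m \<in> min_basis X. config_le m x"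
  using assms(2,3)
proof (induction "\<Sum>r \<in> locs B. snd x r" arbitrary: x rule: less_induct)
  case less
  show ?case
  proof (cases "x \<in> min_basis X")
    case True
    then show ?thesis by (auto simp: config_le_def)
  next
    case False
    then obtain y where y: "y \<in> X" "config_le y x" "y \<noteq> x"
      using less.prems by (auto simp: min_basis_def)
    have yc: "y \<in> configs A B"
      using configs_downward_closed less.prems y by blast
    have le: "snd y r \<le> snd x r" for r
      using y by (simp add: config_le_def le_fun_def)
    have "snd y \<noteq> snd x"
      using y by (auto simp: config_le_def prod_eq_iff)
    then obtain r where r: "snd y r \<noteq> snd x r" by blast
    \<comment> \<open>Both vectors vanish outside \<open>locs B\<close>, so the strict decrease at
      \<open>r\<close> is visible in the sum.\<close>
    moreover have "r \<in> locs B"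
      using r yc less.prems unfolding configs_def by (metis (mono_tags, lifting) case_prod_unfold mem_Collect_eq)
    ultimately have "(\<Sum>r \<in> locs B. snd y r) < (\<Sum>r \<in> locs B. snd x r)"
      using le fin by (intro sum_strict_mono_ex1) (auto intro!: bexI[of _ r] simp: order_less_le)
    then obtain m where "m \<in> min_basis X" "config_le m y"
      using less.hyps y yc by blast
    then show ?thesis using y config_le_trans by blast
  qed
qed

lemma up_min_basis:
  assumes "finite (locs B)" "states M = configs A B"
  shows "up M (min_basis X) = up M X"
proof
  show "up M (min_basis X) \<subseteq> up M X"
    by (rule up_mono) (auto simp: min_basis_def)
  show "up M X \<subseteq> up M (min_basis X)"
  proof
    fix s assume "s \<in> up M X"
    then obtain x where x: "s \<in> states M" "x \<in> X" "config_le x s"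
      by (auto simp: up_def)
    \<comment> \<open>\<open>X\<close> is arbitrary, but \<open>x\<close> lies below the state
      \<open>s\<close>, which is enough to start the descent.\<close>
    then have "x \<in> configs A B"
      using configs_downward_closed assms by metis
    then obtain m where "m \<in> min_basis X" "config_le m x"
      using ex_min_basis_le assms x by metis
    then show "s \<in> up M (min_basis X)"
      using x(1) config_le_trans[OF _ x(3)] unfolding up_def by blast
  qed
qed

lemma subset_up_min_basis:
  assumes "finite (locs B)" "states M = configs A B" "X \<subseteq> states M"
  shows "X \<subseteq> up M (min_basis X)"
  using assms by (subst up_min_basis) (auto simp: up_def config_le_def)

text \<open>The last four assumptions are the loop invariant: up to upward closure,
  \<open>temp\<close> collects all iterates and \<open>visited\<close> all but the newest;
  predecessors of the latter are covered by the iterates after the error set, and these avoid the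
  initial states. \<open>tl\<close> drops the error set, which the loop never compares with
  \<open>inits M\<close>. \<open>F\<close> is existential because it includes iterates still to
  come.\<close>

lemma mc_loop_True_invariant:
  assumes "mc_loop M Es temp visited r" "r = MC_True"
    and fin: "finite (locs B)" and st: "states M = configs A B"
    and src: "\<And>s s'. (s, s') \<in> one_step M \<Longrightarrow> s \<in> states M"
    and "Es \<noteq> []" "up M temp = up M (\<Union>(set Es))" "up M visited = up M (\<Union>(set (butlast Es)))"
      "pred M (up M (\<Union>(set (butlast Es)))) \<subseteq> up M (\<Union>(set (tl Es)))"
      "\<Union>(set (tl Es)) \<inter> inits M = {}"
  shows "\<exists>F. F \<inter> inits M = {} \<and> pred M (up M (\<Union>(set Es) \<union> F)) \<subseteq> up M F"
  using assms(1,2,6-)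
proof (induction rule: mc_loop.induct)
  case (mc_done temp visited Es)
  \<comment> \<open>The witness is the union of \<open>tl Es\<close>. Since
    \<open>temp = visited\<close>, \<open>Es\<close> and \<open>butlast Es\<close> have the same
    upward closure, so the predecessor invariant extends to the newest iterate.\<close>
  have "\<Union>(set Es) \<union> \<Union>(set (tl Es)) = \<Union>(set Es)"
    using mc_done.prems(2) by (cases Es) auto
  then show ?case
    using mc_done by (intro exI[of _ "\<Union>(set (tl Es))"]) simp
next
  case (mc_error temp visited E Es)
  then show ?case by simp
next
  case (mc_iter temp visited E Es r)
  let ?U = "\<Union>(set Es)"
  have E: "pred M (up M (last Es)) \<subseteq> up M E"
    unfolding mc_iter.hyps(2)
    by (rule subset_up_min_basis[OF fin st]) (auto simp: pred_def dest: src)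
  \<comment> \<open>\<open>Es\<close> becomes the \<open>butlast\<close> of the next round: its
    older part is covered by the invariant, its last entry by the new \<open>E\<close>.\<close>
  have U: "?U = \<Union>(set (butlast Es)) \<union> last Es"
    using mc_iter.prems(2) by (cases Es rule: rev_cases) auto
  have "pred M (up M ?U) \<subseteq> up M (\<Union>(set (tl Es)) \<union> E)"
    unfolding U up_Un pred_Un using E mc_iter.prems(5) by blast
  moreover have "up M (min_basis (temp \<union> E)) = up M (?U \<union> E)"
    using mc_iter.prems(3) by (simp add: up_min_basis[OF fin st] up_Un)
  ultimately have "\<exists>F. F \<inter> inits M = {} \<and> pred M (up M (\<Union>(set (Es @ [E])) \<union> F)) \<subseteq> up M F"
    using mc_iter.prems mc_iter.hyps(3) by (intro mc_iter.IH) (auto simp: Un_ac)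
  then obtain F where F: "F \<inter> inits M = {}"
      "pred M (up M (\<Union>(set (Es @ [E])) \<union> F)) \<subseteq> up M F" by blast
  have "pred M (up M (?U \<union> F)) \<subseteq> pred M (up M (\<Union>(set (Es @ [E])) \<union> F))"
    by (intro pred_mono up_mono) auto
  with F show ?case by blast
qed

text \<open>The split into two claims reflects that the error set itself is not tested: a path of
  length zero is excluded only if \<open>ERR\<close> avoids the initial states.\<close>

lemma model_check_True_sound:
  assumes mc: "model_check M ERR MC_True"
    and fin: "finite (locs B)" and st: "states M = configs A B"
    and init: "inits M = init_configs A B"
    and src: "\<And>s s'. (s, s') \<in> one_step M \<Longrightarrow> s \<in> states M"
    and s0: "s\<^sub>0 \<in> inits M" and s: "s \<in> up M ERR"
  shows "(s\<^sub>0, s) \<notin> (one_step M)\<^sup>+"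
    and "ERR \<inter> inits M = {} \<Longrightarrow> (s\<^sub>0, s) \<notin> (one_step M)\<^sup>*"
proof -
  have "\<exists>F. F \<inter> inits M = {} \<and> pred M (up M (\<Union>(set [ERR]) \<union> F)) \<subseteq> up M F"
    \<comment> \<open>At loop entry both \<open>butlast [ERR]\<close> and \<open>tl [ERR]\<close>
      are empty, so the invariant holds trivially.\<close>
    using mc unfolding model_check_def
    by (rule mc_loop_True_invariant[OF _ refl fin st src]) (auto simp: pred_def up_def)
  then obtain F where F: "F \<inter> inits M = {}" "pred M (up M (ERR \<union> F)) \<subseteq> up M F"
    by auto
  have disj: "s\<^sub>0 \<notin> up M X" if "X \<inter> inits M = {}" for X
    using that s0 init_configs_downward_closed unfolding up_def init by fastforce
  have step: "x \<in> up M F" if "(x, y) \<in> one_step M" "y \<in> up M (ERR \<union> F)" for x y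
    using that F by (auto simp: pred_def)
  have "x \<in> up M F" if "(x, s) \<in> (one_step M)\<^sup>+" for x
    using that
    by (induction rule: converse_trancl_induct) (use s in \<open>auto intro: step simp: up_Un\<close>)
  then show plus: "(s\<^sub>0, s) \<notin> (one_step M)\<^sup>+"
    using disj F by blast
  show "(s\<^sub>0, s) \<notin> (one_step M)\<^sup>*" if "ERR \<inter> inits M = {}"
    using plus disj[OF that] s by (auto simp: rtrancl_eq_or_trancl)
qed

lemma fires_source: "fires A B t s s' \<Longrightarrow> s \<in> configs A B"
  by (auto elim: fires.cases)

lemma fires_rule: "fires A B t s s' \<Longrightarrow> t \<in> all_rules A B"
  by (auto simp: all_rules_def elim: fires.cases)

text \<open>This makes the first round, run on the unrestricted system, an instance of the repair
  loop invariant.\<close>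

lemma restrict_csys_all_rules:
  "restrict_csys (counter_system A B) (all_rules A B) = counter_system A B"
  by (auto simp: restrict_csys_def counter_system_def dest: fires_rule)

lemma sat_big_conj: "finite X \<Longrightarrow> sat V (big_conj X) \<longleftrightarrow> (\<forall>\<phi> \<in> X. sat V \<phi>)"
  by (simp add: big_conj_def Abs_fset_inverse)

lemma sat_big_disj: "finite X \<Longrightarrow> sat V (big_disj X) \<longleftrightarrow> (\<exists>\<phi> \<in> X. sat V \<phi>)"
  by (simp add: big_disj_def Abs_fset_inverse)

lemma sat_conjunct: "is_conjunct \<chi> \<phi> \<Longrightarrow> sat V \<phi> \<Longrightarrow> sat V \<chi>"
  by (induction rule: is_conjunct.induct) auto

text \<open>Guards are subsets of the finite set \<open>Q\<close>. Finiteness is what gives the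
  disjunctions in \<open>TRConstr\<close> their intended meaning.\<close>

lemma finite_rules:
  assumes "finite Q" "disjunctive_template Q U"
  shows "finite (rules U)"
proof (rule finite_subset)
  show "rules U \<subseteq> locs U \<times> Pow Q \<times> locs U"
    using assms by (fastforce simp: disjunctive_template_def)
  show "finite (locs U \<times> Pow Q \<times> locs U)"
    using assms by (simp add: disjunctive_template_def)
qed

lemma sat_TRConstr:
  assumes "disjunctive_templates A B"
  shows "sat V (TRConstr A B) \<longleftrightarrow>
    (\<forall>q \<in> locs A. outgoing (rules A) q \<inter> V \<noteq> {}) \<and> (\<forall>q \<in> locs B. outgoing (rules B) q \<inter> V \<noteq> {})"
proof -
  have fl: "finite (locs A)" "finite (locs B)"
    using assms by (auto simp: disjunctive_templates_def disjunctive_template_def)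
  then have "finite (rules A)" "finite (rules B)"
    using assms finite_rules[of "locs A \<union> locs B"] by (auto simp: disjunctive_templates_def)
  then have "finite (outgoing (rules A) q)" "finite (outgoing (rules B) q)" for q
    by (auto simp: outgoing_def)
  with fl show ?thesis
    by (auto simp: TRConstr_def sat_big_conj sat_big_disj)
qed

text \<open>Loop invariant: the current system is the restriction to the current assignment, which
  satisfies \<open>TRConstr\<close>. Each new assignment satisfies \<phi> and hence its conjunct
  \<open>TRConstr\<close>; the loop returns only after a successful check.\<close>

lemma repair_loop_Repaired:
  assumes "repair_loop A B ERR \<phi> M' \<delta>' acc r" "r = Repaired \<delta>"
    and "M' = restrict_csys (counter_system A B) \<delta>'" "sat \<delta>' (TRConstr A B)"
    and "is_conjunct (TRConstr A B) \<phi>"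
  shows "model_check (restrict_csys (counter_system A B) \<delta>) ERR MC_True \<and> sat \<delta> (TRConstr A B)"
  using assms
  by (induction rule: repair_loop.induct) (auto dest: sat_conjunct)

theorem theorem2:
  fixes A B :: "'q template" and ERR :: "'q config set"
    and initConstr :: "'q ltrans form" and \<delta>' :: "'q ltrans set"
  assumes "disjunctive_templates A B"
    and "finite ERR" and "ERR \<subseteq> configs A B"
    and "set_form initConstr \<subseteq> all_rules A B"
    and "is_conjunct (TRConstr A B) initConstr"
    and "param_repair A B ERR initConstr (Repaired \<delta>')"
  defines "M' \<equiv> restrict_csys (counter_system A B) \<delta>'"
  shows "(ERR \<inter> inits M' = {} \<longrightarrow>
            \<not> (\<exists>s\<^sub>0 \<in> inits M'. \<exists>s \<in> up M' ERR. (s\<^sub>0, s) \<in> (one_step M')\<^sup>*)) \<and>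
         \<not> (\<exists>s\<^sub>0 \<in> inits M'. \<exists>s \<in> up M' ERR. (s\<^sub>0, s) \<in> (one_step M')\<^sup>+) \<and>
         (\<forall>q \<in> locs A \<union> locs B. \<exists>t \<in> \<delta>'. t \<in> outgoing (all_rules A B) q)"
proof -
  have fin: "finite (locs B)"
    using assms(1) by (simp add: disjunctive_templates_def disjunctive_template_def)
  \<comment> \<open>The initial assignment is not produced by the solver; here totality of the
    templates establishes the constraint.\<close>
  have "sat (all_rules A B) (TRConstr A B)"
    unfolding sat_TRConstr[OF assms(1)] using assms(1)
    by (fastforce simp: disjunctive_templates_def disjunctive_template_def all_rules_def outgoing_def)
  with repair_loop_Repaired[OF assms(6)[unfolded param_repair_def] refl
      restrict_csys_all_rules[symmetric] _ assms(5)]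
  have mc: "model_check M' ERR MC_True" and sat: "sat \<delta>' (TRConstr A B)"
    by (auto simp: M'_def)
  have st: "states M' = configs A B" and init: "inits M' = init_configs A B"
    by (simp_all add: M'_def restrict_csys_def counter_system_def)
  have src: "s \<in> states M'" if "(s, s') \<in> one_step M'" for s s'
    using that unfolding st
    by (auto simp: M'_def one_step_def restrict_csys_def counter_system_def dest: fires_source)
  have "\<forall>q \<in> locs A \<union> locs B. \<exists>t \<in> \<delta>'. t \<in> outgoing (all_rules A B) q"
    using sat unfolding sat_TRConstr[OF assms(1)] by (fastforce simp: outgoing_def all_rules_def)
  then show ?thesis
    using model_check_True_sound[OF mc fin st init] src by blast
qed

end
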